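(* Let $G$ be a nonempty Dots & Boxes position that consists of loops and long chains. In each of the following cases, opening a shortest loop of $G$ is optimal: (1) $c(G)\ge 2$ and $G$ consists of exactly one $3$-chain together with one or more loops (and nothing else); (2) $c(G)\in\{-1,0,1\}$ and $G=4_\ell+H$, where $H$ is any (possibly empty) position other than $3+3+3$; (3) $c(G)\le -2$ and $G=4_\ell+3+H$, where $4\mid \mathrm{size}(H)$ and $H$ has no $3$-chains. In all other cases the standard move is optimal, where the standard move means: open a $3$-chain if $G$ has one; otherwise open a shortest loop if $G$ has a loop; otherwise open a shortest chain.
   Context: Positions. A (Dots & Boxes) position $G$ consisting of loops and long chains is a finite multiset of components, each of which is either a chain of some integer length $\ge 3$ (a "long chain", or just "chain") or a loop of some even integer length $\ge 4$. All components are unopened. An $N$-chain is written $N$ and an $N$-loop is written $N_\ell$; positions are written additively (e.g. $3+4_\ell+8_\ell$ is a $3$-chain, a $4$-loop and an $8$-loop), exponents denote multiplicity, and $G-C$ denotes $G$ with the component $C$ removed. $\mathrm{size}(G)$ is the sum of the lengths of the components (the number of unclaimed boxes); $\mathrm{size}(C)$ is the length of the component $C$. Play and value. In a nonempty position the player to move (the opener) must choose a component $C$ to open. The other player (the controller) then either gives up control, i.e. captures all boxes of $C$ and becomes the opener in $G-C$, or keeps control, i.e. captures all but $2$ boxes of $C$ if $C$ is a chain (all but $4$ if $C$ is a loop), the leftover boxes being captured by the opener, who is then again the opener in $G-C$. Each player maximizes the number of boxes he captures. The value $v(G)$ is the margin by which the controller outscores the opener in $G$ under optimal play, and $v(G;C)$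 is this margin given that the opener has just opened $C$. So $v(\emptyset)=0$, $v(G)=\min_C v(G;C)$ over the components $C$ of a nonempty $G$, and $$v(G;C)=\max\{\mathrm{size}(C)-2k+v(G-C),\ \mathrm{size}(C)-v(G-C)\}=(\mathrm{size}(C)-k)+|v(G-C)-k|,$$ with $k=2$ if $C$ is a chain and $k=4$ if $C$ is a loop. Opening $C$ is optimal if $v(G;C)=v(G)$. Controlled value. $c(G)=\mathrm{size}(G)-4(\text{number of chains})-8(\text{number of loops})+\mathrm{tb}(G)$, where the terminal bonus $\mathrm{tb}(G)$ is $0$ if $G$ is empty; $8$ if $G$ consists of one or more loops and nothing else; $6$ if $G$ consists of one or more loops and one or more $3$-chains and nothing else; and $4$ otherwise. *)

theory Defs
  imports Main "HOL-Library.Multiset"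
begin

datatype component = is_chain: Chain (len: nat) | is_loop: Loop (len: nat)

fun valid_component :: "component \<Rightarrow> bool" where
  "valid_component (Chain n) \<longleftrightarrow> 3 \<le> n"
| "valid_component (Loop n) \<longleftrightarrow> 4 \<le> n \<and> even n"

type_synonym position = "component multiset"

definition valid_position :: "position \<Rightarrow> bool" where
  "valid_position G \<longleftrightarrow> (\<forall>C\<in>#G. valid_component C)"

(* The number of unclaimed boxes; the library's size G is the number of components. *)
definition boxes :: "position \<Rightarrow> nat" where
  "boxes G = (\<Sum>C\<in>#G. len C)"

(* The boxes the controller leaves to the opener when he keeps control. *)
fun sacrifice :: "component \<Rightarrow> int" where
  "sacrifice (Chain n) = 2"
| "sacrifice (Loop n) = 4"

(* The controller's margin once C has been opened, where w is the value of what remains.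
   First argument of max: he keeps control, so the opener gets the sacrificed boxes and opens
   again.  Second argument: he takes all of C and becomes the opener himself. *)
definition open_margin :: "component \<Rightarrow> int \<Rightarrow> int" where
  "open_margin C w =
     max ((int (len C) - sacrifice C) - sacrifice C + w) (int (len C) - w)"

function val :: "position \<Rightarrow> int" where
  "val G = (if G = {#} then 0
            else Min ((\<lambda>C. open_margin C (val (G - {#C#}))) ` set_mset G))"
  by pat_completeness auto
termination
  by (relation "measure size") (auto simp: size_Diff1_less)

declare val.simps [simp del]

definition val_open :: "position \<Rightarrow> component \<Rightarrow> int" where
  "val_open G C = open_margin C (val (G - {#C#}))"

definition optimal_opening :: "position \<Rightarrow> component \<Rightarrow> bool" where
  "optimal_opening G C \<longleftrightarrow> C \<in># G \<and> val_open G C = val G"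

definition terminal_bonus :: "position \<Rightarrow> int" where
  "terminal_bonus G =
     (if G = {#} then 0
      else if \<forall>C\<in>#G. is_loop C then 8
      else if (\<forall>C\<in>#G. is_loop C \<or> C = Chain 3) \<and> (\<exists>C\<in>#G. is_loop C) \<and> Chain 3 \<in># G then 6
      else 4)"

definition controlled_value :: "position \<Rightarrow> int" where
  "controlled_value G =
     int (boxes G) - 4 * int (size (filter_mset is_chain G))
       - 8 * int (size (filter_mset is_loop G)) + terminal_bonus G"

(* A component is determined by its kind and its length, so all shortest loops (chains) of a
   position are equal.  The two values below are components of G only if G has a loop (chain). *)
definition shortest_loop :: "position \<Rightarrow> component" where
  "shortest_loop G = Loop (LEAST n. Loop n \<in># G)"

definition shortest_chain :: "position \<Rightarrow> component" where
  "shortest_chain G = Chain (LEAST n. Chain n \<in># G)"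

definition standard_move :: "position \<Rightarrow> component" where
  "standard_move G =
     (if Chain 3 \<in># G then Chain 3
      else if \<exists>C\<in>#G. is_loop C then shortest_loop G
      else shortest_chain G)"

definition one_three_chain_and_loops :: "position \<Rightarrow> bool" where
  "one_three_chain_and_loops G \<longleftrightarrow>
     (\<exists>L. L \<noteq> {#} \<and> (\<forall>C\<in>#L. is_loop C) \<and> G = {#Chain 3#} + L)"

definition exceptional :: "position \<Rightarrow> bool" where
  "exceptional G \<longleftrightarrow>
     (controlled_value G \<ge> 2 \<and> one_three_chain_and_loops G)
   \<or> (controlled_value G \<in> {-1, 0, 1} \<and>
       (\<exists>H. G = {#Loop 4#} + H \<and> H \<noteq> {#Chain 3, Chain 3, Chain 3#}))
   \<or> (controlled_value G \<le> -2 \<and>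
       (\<exists>H. G = {#Loop 4, Chain 3#} + H \<and> 4 dvd boxes H \<and> Chain 3 \<notin># H))"

end

theory Submission imports Defs begin

text \<open>
  All values can be written down in closed form, and then the theorem is a comparison of numbers.
  Let \<open>c\<close> be the controlled value of a position, \<open>s\<close> its number of boxes, and let \<open>w\<close> be the value of
  what remains after a component of length \<open>N\<close> is opened; the margin of that opening is
  \<open>N - k + \<bar>w - k\<bar>\<close>, with \<open>k = 2\<close> for chains and \<open>k = 4\<close> for loops.

  If \<open>c \<ge> 2\<close>, the value is \<open>c\<close>. The value is never below the controlled value, so by keeping control
  the controller obtains at least \<open>N - 2 k + w \<ge> c\<close> up to a change of the terminal bonus; conversely the
  recommended opening leaves a controlled value of at least \<open>k\<close>, so that keeping control is his best
  reply and yields exactly \<open>c\<close>. (The last component, and a loop beside a single 3-chain, give \<open>c\<close> by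
  direct computation.)

  If \<open>c \<le> 1\<close>, the value lies between 0 and 4 and has the parity of \<open>s\<close>
  (\<open>low_value\<close>). Hence the openings of chains of length at least 6 and of loops of length at least 8,
  whose margin is at least 4, satisfy the lower bound trivially, and only five kinds of components are left.
  They act on small \<open>w\<close> as follows. A 4-loop turns \<open>w\<close> into \<open>4 - w\<close> and raises \<open>c\<close> by 4. A 3-chain turns
  \<open>w\<close> into \<open>1 + \<bar>w - 2\<bar>\<close>, which pushes all values towards 1 and 2. Without 3-chains the value is
  therefore 2 if \<open>s\<close> is 2 modulo 4, and otherwise it alternates between 4 and 0, or between 3 and 1, as
  4-loops are opened one after the other until they are used up or the controlled value reaches 2. The
  parity of the number of these reflections (\<open>loop_flips\<close>) decides. With 3-chains the value is
  the least number of the right parity that is not 0, with these deviations, which are the sources of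
  the exceptional cases:

  \<^item> If \<open>c\<close> is -1, 0 or 1, opening a 4-loop leaves a value near 4, hence yields the least value 0 or 1.
    Only in \<open>4\<^sub>l+3+3\<close> and \<open>4\<^sub>l+3+3+3\<close> does the loss of terminal bonus spoil this: after the loop, what
    remains is worth 2 and 1 instead of 4 and 3. In the first position the loop is still optimal.
  \<^item> With exactly one 3-chain and \<open>s\<close> equal to 3 modulo 4, opening the 3-chain leaves a value 0 or 4 and
    costs 3, whereas opening a 4-loop costs 1 after an odd number of reflections, and 3 otherwise.

  The formula (\<open>position_value\<close>) is the value by induction on the position: no opening beats it
  (\<open>position_value_le_open_margin\<close>), and the recommended one attains it
  (\<open>recommended_move_attains\<close>). Both statements are first proved for the numbers involved and
  then transferred to positions by following controlled value, terminal bonus and counts through the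
  removal of one component.
\<close>

section \<open>A closed formula for the value\<close>

text \<open>
  The number of 4-loops that are opened in succession. Each of them raises the controlled value by
  4, and for \<open>c \<le> 1\<close> the least \<open>j\<close> with \<open>c + 4 * j \<ge> 2\<close> is \<open>(5 - c) div 4\<close>; the players stop there, or
  earlier when all \<open>b\<close> of them are gone.
\<close>
definition loop_flips :: "int \<Rightarrow> int \<Rightarrow> int" where
  "loop_flips c b = min b ((5 - c) div 4)"

text \<open>
  The value at controlled value \<open>c \<le> 1\<close> of a nonempty position with \<open>a\<close> 3-chains, \<open>b\<close> 4-loops and
  \<open>s\<close> boxes. The triple \<open>a = 2\<close>, \<open>b = 1\<close>, \<open>s = 10\<close> occurs for \<open>4\<^sub>l+3+3\<close> only.
\<close>
definition low_value :: "int \<Rightarrow> int \<Rightarrow> int \<Rightarrow> int \<Rightarrow> int" where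
  "low_value c a b s =
     (if a = 0 then
        if s mod 4 = 2 then 2
        else if even s then if even (loop_flips c b) then 4 else 0
        else if even (loop_flips c b) then 3 else 1
      else if b > 0 \<and> c \<ge> -1 then if a = 2 \<and> b = 1 \<and> s = 10 then 2 else if even s then 0 else 1
      else if even s then 2
      else if a = 1 \<and> s mod 4 = 3 \<and> even (loop_flips c b) then 3 else 1)"

definition value_formula :: "int \<Rightarrow> int \<Rightarrow> int \<Rightarrow> int \<Rightarrow> int" where
  "value_formula c a b s = (if c \<ge> 2 then c else low_value c a b s)"

lemma low_value_range: "0 \<le> low_value c a b s" "low_value c a b s \<le> 4"
  by (auto simp: low_value_def)

lemma even_low_value_iff: "even (low_value c a b s) \<longleftrightarrow> even s"
proof -
  have "s mod 4 = 2 \<Longrightarrow> even s" "s mod 4 = 3 \<Longrightarrow> odd s"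
    by presburger+
  then show ?thesis
    by (auto simp: low_value_def)
qed

lemma low_value_mod_4: "even s \<Longrightarrow> 4 dvd low_value c 0 b s - s"
proof -
  have "4 dvd x - s \<longleftrightarrow> x mod 4 = s mod 4" for x :: int
    by presburger
  moreover have "even s \<Longrightarrow> s mod 4 = 0 \<or> s mod 4 = 2"
    by presburger
  ultimately show "even s \<Longrightarrow> 4 dvd low_value c 0 b s - s"
    by (auto simp: low_value_def)
qed

lemma value_formula_nonneg: "0 \<le> value_formula c a b s"
  by (simp add: value_formula_def low_value_range)

lemma even_value_formula_iff: "even (c - s) \<Longrightarrow> even (value_formula c a b s) \<longleftrightarrow> even s"
  by (auto simp: value_formula_def even_low_value_iff)

text \<open>
  Without 3-chains the terminal bonus is a multiple of 4, so that \<open>c\<close> and \<open>s\<close> agree modulo 4. That even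
  values then agree with \<open>s\<close> modulo 4, not just modulo 2, settles most of the comparisons below.
\<close>
lemma value_formula_mod_4: "even s \<Longrightarrow> 4 dvd c - s \<Longrightarrow> 4 dvd value_formula c 0 b s - s"
  by (auto simp: value_formula_def low_value_mod_4)

text \<open>
  For \<open>c = 1\<close> this rests on parity, as an odd nonnegative value is at least 1.
\<close>
lemma value_formula_ge_controlled_value: assumes "even (c - s)" shows "c \<le> value_formula c a b s"
proof (cases "c \<ge> 1")
  case True
  then show ?thesis
    using even_low_value_iff[of c a b s] low_value_range(1)[of c a b s] assms
    by (cases "c = 1") (auto simp: value_formula_def order.order_iff_strict)
next
  case False
  then show ?thesis using value_formula_nonneg[of c a b s] by linarith
qed

section \<open>Small components do not beat the low values\<close>

text \<open>
  Here and below, \<open>a\<close>, \<open>b\<close>, \<open>s\<close> and \<open>c'\<close> belong to the position that remains after the opening, and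
  \<open>c\<close> is the controlled value before it. The value 2 needs an odd number of boxes in the rest,
  whose value is then odd and different from 2; the value 3 needs a rest without 3-chains and with
  \<open>4 dvd s\<close>.
\<close>
lemma low_value_le_opening_3_chain:
  assumes "0 \<le> a" "even (c' - s)" "a = 0 \<Longrightarrow> 4 dvd c' - s"
  shows "low_value c (a + 1) b (s + 3) \<le> 1 + \<bar>value_formula c' a b s - 2\<bar>"
proof -
  note par = even_value_formula_iff[OF assms(2), of a b]
  consider "low_value c (a + 1) b (s + 3) \<le> 1"
    | "odd s" "low_value c (a + 1) b (s + 3) \<le> 2"
    | "a = 0" "4 dvd s" "low_value c (a + 1) b (s + 3) \<le> 3"
  proof -
    have "a \<noteq> 0 \<or> (s + 3) mod 4 \<noteq> 3 \<or> 4 dvd s" by presburger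
    then show thesis using that assms(1) by (fastforce simp: low_value_def split: if_splits)
  qed
  then show ?thesis
  proof cases
    \<comment> \<open>The rest is worth a multiple of 4, hence not 2.\<close>
    case 3
    then show ?thesis using value_formula_mod_4[of s c' b] assms(3) by presburger
  qed (use par in presburger)+
qed

text \<open>
  If the value is 4, then the rest is worth a multiple of 4 and \<open>\<bar>w - 2\<bar> \<ge> 2\<close>; if it is 3, then \<open>w\<close> is odd
  and \<open>\<bar>w - 2\<bar> \<ge> 1\<close>.
\<close>
lemma low_value_le_opening_4_chain:
  assumes "even (c' - s)" "a = 0 \<Longrightarrow> 4 dvd c' - s"
  shows "low_value c a b (s + 4) \<le> 2 + \<bar>value_formula c' a b s - 2\<bar>"
proof (cases "a = 0 \<and> even s")
  case True
  then have "4 dvd value_formula c' a b s - s" using value_formula_mod_4[of s c' b] assms by auto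
  moreover have "low_value c a b (s + 4) \<le> 2 \<or> low_value c a b (s + 4) \<le> 4 \<and> 4 dvd s"
    using True by (auto simp: low_value_def) presburger
  ultimately show ?thesis by presburger
next
  case False
  have "low_value c a b (s + 4) \<le> 2 \<or> low_value c a b (s + 4) \<le> 3 \<and> odd s"
    using False by (auto simp: low_value_def)
  then show ?thesis using even_value_formula_iff[OF assms(1), of a b] by presburger
qed

text \<open>
  Parity suffices: either the value is odd, hence at most 3, or \<open>w\<close> is odd and \<open>\<bar>w - 2\<bar> \<ge> 1\<close>.
\<close>
lemma low_value_le_opening_5_chain:
  assumes "even (c' - s)"
  shows "low_value c a b (s + 5) \<le> 3 + \<bar>value_formula c' a b s - 2\<bar>"
proof (cases "even s")
  case True
  then have "odd (low_value c a b (s + 5))" by (simp add: even_low_value_iff)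
  then show ?thesis using low_value_range(2)[of c a b "s + 5"] by presburger
next
  case False
  then have "odd (value_formula c' a b s)" using even_value_formula_iff[OF assms] by simp
  then have "1 \<le> \<bar>value_formula c' a b s - 2\<bar>" by presburger
  then show ?thesis using low_value_range(2)[of c a b "s + 5"] by linarith
qed

text \<open>
  If the value is 4, then \<open>w\<close> is 2 modulo 4 and therefore at distance at least 2 from 4; if it is 3, then
  \<open>w\<close> is odd and at distance at least 1.
\<close>
lemma low_value_le_opening_6_loop:
  assumes "even (c' - s)" "a = 0 \<Longrightarrow> 4 dvd c' - s"
  shows "low_value c a b (s + 6) \<le> 2 + \<bar>value_formula c' a b s - 4\<bar>"
proof (cases "a = 0 \<and> even s")
  case True
  then have "even s" and "4 dvd value_formula c' a b s - s" using value_formula_mod_4[of s c' b] assms by auto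
  moreover have "low_value c a b (s + 6) \<le> 2 \<or> low_value c a b (s + 6) \<le> 4 \<and> \<not> 4 dvd s"
  proof -
    have "even s \<Longrightarrow> \<not> 4 dvd s \<or> (s + 6) mod 4 = 2" by presburger
    then show ?thesis
    using True by (auto simp: low_value_def)
  qed
  ultimately show ?thesis by presburger
next
  case False
  have "low_value c a b (s + 6) \<le> 2 \<or> low_value c a b (s + 6) \<le> 3 \<and> odd s"
    using False by (auto simp: low_value_def)
  then show ?thesis using even_value_formula_iff[OF assms(1), of a b] by presburger
qed

lemma loop_flips_step:
  "c \<le> -2 \<Longrightarrow> loop_flips c (b + 1) = loop_flips (c + 4) b + 1"
  by (simp add: loop_flips_def)

lemma loop_flips_last: "-1 \<le> c \<Longrightarrow> c \<le> 1 \<Longrightarrow> 0 \<le> b \<Longrightarrow> loop_flips c (b + 1) = 1"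
  by (simp add: loop_flips_def)

text \<open>
  Without 3-chains, \<open>low_value\<close> follows the reflection \<open>w \<mapsto> 4 - w\<close> exactly:
  the number of flips grows by one while the controlled value stays below 2, and a controlled value of
  3, 4 or 5 after the opening means that this was the only flip.
\<close>
lemma low_value_reflected_by_4_loop:
  assumes "c \<le> 1" "0 \<le> b" "4 dvd c - s"
  shows "low_value c 0 (b + 1) (s + 4) = \<bar>value_formula (c + 4) 0 b s - 4\<bar>"
proof (cases "c \<le> -2")
  case True
  show ?thesis
  proof (cases "c = -2")
    case True
    then have "s mod 4 = 2" using assms by presburger
    then show ?thesis using True by (simp add: low_value_def value_formula_def)
  next
    case False
    then show ?thesis using True assms
      by (auto simp: value_formula_def low_value_def loop_flips_step)
  qed
next
  case False
  then have "c = -1 \<and> s mod 4 = 3 \<or> c = 0 \<and> s mod 4 = 0 \<or> c = 1 \<and> s mod 4 = 1"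
    using assms by presburger
  moreover have "s mod 4 = 3 \<Longrightarrow> odd s" "s mod 4 = 0 \<Longrightarrow> even s" "s mod 4 = 1 \<Longrightarrow> odd s"
    by presburger+
  ultimately show ?thesis using assms(2)
    by (auto simp: low_value_def value_formula_def loop_flips_last)
qed

text \<open>
  The opening would be too good only for \<open>w = 4\<close> or \<open>w \<in> {3, 5}\<close>. But for \<open>c \<le> -2\<close> the rest has a
  controlled value of at most 2, where a 3-chain keeps even values at or below 2; and a value 3 before the
  opening means an even number of flips, so an odd number after it and \<open>w = 1\<close>. The bound \<open>c' \<le> c + 4\<close>
  allows for a loss of terminal bonus when the last loop goes; \<open>a = 2\<close>, \<open>b = 0\<close>, \<open>s = 6\<close> is the rest \<open>3+3\<close>.
\<close>
lemma low_value_le_opening_4_loop: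
  assumes "0 < a" "0 \<le> b" "even (c' - s)" "c' \<le> c + 4" "a = 1 \<Longrightarrow> c \<le> -2 \<Longrightarrow> c' = c + 4"
    and "a = 2 \<Longrightarrow> b = 0 \<Longrightarrow> s = 6 \<Longrightarrow> c' = 2"
  shows "low_value c a (b + 1) (s + 4) \<le> \<bar>value_formula c' a b s - 4\<bar>"
proof -
  note par = even_value_formula_iff[OF assms(3), of a b]
  consider "low_value c a (b + 1) (s + 4) = 0" | "low_value c a (b + 1) (s + 4) = 1" "odd s"
    | "low_value c a (b + 1) (s + 4) = 2" "even s" "c \<le> -2 \<or> a = 2 \<and> b = 0 \<and> s = 6"
    | "low_value c a (b + 1) (s + 4) = 3" "odd s" "a = 1" "c \<le> -2" "even (loop_flips c (b + 1))"
    using assms(1,2) by (fastforce simp: low_value_def split: if_splits)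
  then show ?thesis
  proof cases
    case 3
    then have "value_formula c' a b s \<noteq> 4"
      using assms by (auto simp: low_value_def value_formula_def)
    moreover have "even (value_formula c' a b s)" using par 3 by simp
    ultimately have "2 \<le> \<bar>value_formula c' a b s - 4\<bar>" by presburger
    then show ?thesis using 3 by simp
  next
    case 4
    then have "c' = c + 4" "odd c'" using assms by auto
    then have "c \<noteq> -2" by auto
    then have "value_formula c' a b s = 1"
      using 4 \<open>c' = c + 4\<close> loop_flips_step[of c b] by (auto simp: low_value_def value_formula_def)
    then show ?thesis using 4 by simp
  next
    case 2
    then have "odd (value_formula c' a b s)" using par by simp
    then have "1 \<le> \<bar>value_formula c' a b s - 4\<bar>" by presburger
    then show ?thesis using 2 by simp
  qed simp
qed

section \<open>Openings that attain the low values\<close>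

text \<open>
  The second exceptional case in the presence of 3-chains. The alternatives for \<open>c'\<close> are the general
  one, and the loss of terminal bonus in the openings of the loop in \<open>4\<^sub>l+3\<close> and \<open>4\<^sub>l+3+3\<close>.
\<close>
lemma low_value_eq_opening_4_loop_near_0:
  assumes "0 < a" "0 \<le> b" "even (c' - s)" "-1 \<le> c" "c \<le> 1"
    and "c' = c + 4 \<or> c' = 3 \<and> c = 1 \<or> c' = 2 \<and> a = 2 \<and> b = 0 \<and> s = 6"
    and "a = 2 \<Longrightarrow> b = 0 \<Longrightarrow> s = 6 \<Longrightarrow> c' = 2"
  shows "\<bar>value_formula c' a b s - 4\<bar> = low_value c a (b + 1) (s + 4)"
proof -
  have low: "low_value c a (b + 1) (s + 4) = (if a = 2 \<and> b = 0 \<and> s = 6 then 2 else if even s then 0 else 1)"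
    using assms(1,2,4) by (simp add: low_value_def)
  show ?thesis
  proof (cases "a = 2 \<and> b = 0 \<and> s = 6")
    case True
    then have "c' = 2" "low_value c a (b + 1) (s + 4) = 2" using assms(7) low by auto
    then show ?thesis by (simp add: value_formula_def)
  next
    case False
    then have "c' = c + 4 \<or> c' = 3" using assms(6) by blast
    then have "3 \<le> c'" "c' \<le> 5" using assms(4,5) by auto
    then have "\<bar>c' - 4\<bar> = (if even s then 0 else 1)" using assms(3) by presburger
    then show ?thesis using False low \<open>3 \<le> c'\<close> by (simp add: value_formula_def)
  qed
qed

text \<open>
  The third exceptional case: with a single 3-chain and \<open>s mod 4 = 3\<close> the value still alternates between
  3 and 1 with the parity of the flips.
\<close>
lemma low_value_eq_opening_4_loop_one_3_chain:
  assumes "0 \<le> b" "even (c - s)" "c \<le> -2" "s mod 4 = 3"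
  shows "\<bar>value_formula (c + 4) 1 b s - 4\<bar> = low_value c 1 (b + 1) (s + 4)"
proof -
  have "odd s" using assms by presburger
  then have "c \<noteq> -2" using assms by auto
  moreover have "b > 0 \<Longrightarrow> loop_flips (c + 4) b = 1" if "-5 \<le> c"
  proof -
    have "(5 - (c + 4)) div 4 = 1" using that \<open>c \<le> -2\<close> \<open>c \<noteq> -2\<close> by presburger
    then show "b > 0 \<Longrightarrow> loop_flips (c + 4) b = 1" by (simp add: loop_flips_def)
  qed
  ultimately show ?thesis using assms \<open>odd s\<close>
    by (auto simp: value_formula_def low_value_def loop_flips_step)
qed

text \<open>
  Opening a 3-chain attains the low values outside the second and third exceptional case, which the
  last two assumptions exclude; the one case with \<open>-1 \<le> c\<close> and a 4-loop that remains is \<open>4\<^sub>l+3+3+3\<close>. For odd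
  \<open>s\<close> the rest is worth 1 or 3. For even \<open>s\<close> it is worth 2, unless it has no 3-chains and \<open>4 dvd s\<close>.
\<close>
lemma opening_3_chain_le_low_value:
  assumes "0 \<le> a" "0 \<le> b" "c \<le> 1" "c' = c + 1 \<or> a = 0 \<and> c' = c + 3" "even (c' - s)"
    and "a = 0 \<Longrightarrow> 4 dvd c' - s" "-1 \<le> c \<Longrightarrow> 0 < b \<Longrightarrow> a = 2 \<and> b = 1 \<and> s = 10"
    and "a = 0 \<Longrightarrow> b > 0 \<Longrightarrow> \<not> 4 dvd s"
  shows "1 + \<bar>value_formula c' a b s - 2\<bar> \<le> low_value c (a + 1) b (s + 3)"
proof -
  note par = even_value_formula_iff[OF assms(5), of a b]
  have G: "low_value c (a + 1) b (s + 3) = (if odd s then 2 else if a = 0 \<and> (s + 3) mod 4 = 3 \<and> even (loop_flips c b) then 3 else 1)"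
    using assms(1,2,7) by (auto simp: low_value_def)
  have ub: "value_formula c' a b s \<le> 4" using assms by (auto simp: value_formula_def low_value_range)
  show ?thesis
  proof (cases "even s")
    case False
    then show ?thesis using par G ub value_formula_nonneg[of c' a b s] by presburger
  next
    case ev: True
    show ?thesis
    proof (cases "a = 0")
      case True
      then have *: "4 dvd value_formula c' a b s - s" using value_formula_mod_4[of s c' b] assms ev by auto
      show ?thesis
      proof (cases "4 dvd s")
        \<comment> \<open>The rest is worth 0 or 4, and either way the opening costs 3.\<close>
        case True
        then have "b = 0" using assms \<open>a = 0\<close> by force
        then have "loop_flips c b = 0" using assms by (simp add: loop_flips_def)
        moreover have "(s + 3) mod 4 = 3" using True by presburger
        ultimately show ?thesis using G ub value_formula_nonneg[of c' a b s] True ev \<open>a = 0\<close> by simp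
      next
        case False
        then have "value_formula c' a b s = 2" using * ub value_formula_nonneg[of c' a b s] ev by presburger
        then show ?thesis using G by auto
      qed
    next
      case False
      \<comment> \<open>The parity of c rules out that opening the 3-chain leads to a controlled value -1 or 1.\<close>
      have "c \<noteq> 0" "c \<noteq> -2" using assms False ev by auto
      then have "c' = 2 \<or> c \<ge> -1 \<or> c' < -1"
        using False assms by auto
      then have "value_formula c' a b s = 2"
        using False assms ev by (auto simp: value_formula_def low_value_def)
      then show ?thesis using G by auto
    qed
  qed
qed

text \<open>
  With neither 3-chains nor 4-loops, opening a 6-loop moves \<open>s\<close> by 2 modulo 4 and exchanges the
  values 4 and 2, while 3 stays fixed.
\<close>
lemma low_value_eq_opening_6_loop:
  assumes "c \<le> 1" "4 dvd c + 2 - s"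
  shows "2 + \<bar>value_formula (c + 2) 0 0 s - 4\<bar> = low_value c 0 0 (s + 6)"
proof -
  have fl: "loop_flips c 0 = 0" "c \<le> -1 \<Longrightarrow> loop_flips (c + 2) 0 = 0" using assms by (simp_all add: loop_flips_def)
  have "s mod 4 = 0 \<and> (s + 6) mod 4 = 2 \<and> even s \<or> s mod 4 = 2 \<and> (s + 6) mod 4 = 0 \<and> even s \<or> odd s \<and> (s + 6) mod 4 \<noteq> 2 \<and> s mod 4 \<noteq> 2" by presburger
  moreover have "c = 0 \<and> s mod 4 = 2 \<or> c = 1 \<and> odd s \<or> c \<le> -1"
    using assms by presburger
  ultimately show ?thesis
    using assms by (auto simp: value_formula_def low_value_def fl)
qed

section \<open>Controlled value and terminal bonus when a component is removed\<close>

lemma open_margin_chain: "open_margin (Chain n) w = int n - 2 + \<bar>w - 2\<bar>"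
  by (simp add: open_margin_def)

lemma open_margin_loop: "open_margin (Loop n) w = int n - 4 + \<bar>w - 4\<bar>"
  by (simp add: open_margin_def)

lemma open_margin_0: "open_margin C 0 = int (len C)"
  by (cases C) (simp_all add: open_margin_def)

lemma valid_position_add [simp]:
  "valid_position (add_mset C R) \<longleftrightarrow> valid_component C \<and> valid_position R"
  by (simp add: valid_position_def)

lemma valid_position_diff: "valid_position G \<Longrightarrow> valid_position (G - H)"
  by (auto simp: valid_position_def dest: in_diffD)

lemma boxes_empty [simp]: "boxes {#} = 0"
  by (simp add: boxes_def)

lemma boxes_add [simp]: "boxes (add_mset C R) = len C + boxes R"
  by (simp add: boxes_def)

lemma controlled_value_add:
  "controlled_value (add_mset C R) = controlled_value R + int (len C) - 2 * sacrifice C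
     + terminal_bonus (add_mset C R) - terminal_bonus R"
  by (cases C) (simp_all add: controlled_value_def)

lemma even_terminal_bonus: "even (terminal_bonus G)"
  by (simp add: terminal_bonus_def)

lemma controlled_value_parity: "even (controlled_value G - int (boxes G))"
  by (simp add: controlled_value_def even_terminal_bonus)

lemma controlled_value_mod_4:
  assumes "Chain 3 \<notin># G"
  shows "4 dvd controlled_value G - int (boxes G)"
proof -
  have "4 dvd terminal_bonus G"
    using assms by (simp add: terminal_bonus_def)
  then show ?thesis
    unfolding controlled_value_def by presburger
qed

lemma terminal_bonus_all_loops: "R \<noteq> {#} \<Longrightarrow> \<forall>C\<in>#R. is_loop C \<Longrightarrow> terminal_bonus R = 8"
  by (simp add: terminal_bonus_def)

lemma terminal_bonus_long_chain:
  assumes "C \<in># G" "\<not> is_loop C" "C \<noteq> Chain 3"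
  shows "terminal_bonus G = 4"
proof -
  have "G \<noteq> {#}" "\<not> (\<forall>C\<in>#G. is_loop C)" "\<not> (\<forall>C\<in>#G. is_loop C \<or> C = Chain 3)"
    using assms by auto
  then show ?thesis by (simp only: terminal_bonus_def if_False simp_thms)
qed

lemma terminal_bonus_3_chains_and_loops:
  assumes "\<exists>C\<in>#G. is_loop C" "Chain 3 \<in># G" "\<forall>C\<in>#G. is_loop C \<or> C = Chain 3"
  shows "terminal_bonus G = 6"
proof -
  have ne: "G \<noteq> {#}" and nl: "\<not> (\<forall>C\<in>#G. is_loop C)"
    using assms(2) by force+
  show ?thesis
    unfolding terminal_bonus_def if_not_P[OF ne] if_not_P[OF nl]
    using assms by (intro if_P) blast
qed

lemma terminal_bonus_ge_4: "R \<noteq> {#} \<Longrightarrow> 4 \<le> terminal_bonus R"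
  by (simp add: terminal_bonus_def)

lemma terminal_bonus_add_loop:
  assumes "R \<noteq> {#}"
  shows "terminal_bonus (add_mset (Loop n) R)
     = (if set_mset R = {Chain 3} then 6 else terminal_bonus R)"
proof -
  consider "set_mset R = {Chain 3}" | "\<exists>C\<in>#R. is_loop C" | "\<exists>C\<in>#R. \<not> is_loop C \<and> C \<noteq> Chain 3"
    using assms by (metis (full_types) insertI1 set_mset_eq_empty_iff subsetI subset_singletonD singletonI)
  then show ?thesis
  proof cases
    case 1
    then show ?thesis by (simp add: terminal_bonus_def)
  next
    case 2
    then have "set_mset R \<noteq> {Chain 3}" by force
    with 2 assms show ?thesis by (simp add: terminal_bonus_def)
  next
    case 3
    then obtain C where C: "C \<in># R" "\<not> is_loop C" "C \<noteq> Chain 3" by blast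
    then have "set_mset R \<noteq> {Chain 3}" by auto
    then show ?thesis
      using terminal_bonus_long_chain[OF C] terminal_bonus_long_chain[of C "add_mset (Loop n) R"] C by simp
  qed
qed

lemma terminal_bonus_add_3_chain:
  assumes "R \<noteq> {#}"
  shows "terminal_bonus (add_mset (Chain 3) R)
     = (if \<forall>C\<in>#R. is_loop C then 6 else terminal_bonus R)"
proof (cases "\<forall>C\<in>#R. is_loop C")
  case True
  moreover obtain C where "C \<in># R" using assms by blast
  ultimately have "\<exists>C\<in>#R. is_loop C" by blast
  with True show ?thesis by (simp add: terminal_bonus_def)
next
  case False
  show ?thesis
  proof (cases "\<forall>C\<in>#R. is_loop C \<or> C = Chain 3")
    case True
    then have "Chain 3 \<in># R" using False by metis
    then show ?thesis using assms False True by (simp add: terminal_bonus_def)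
  next
    case nt: False
    then show ?thesis using assms False by (simp add: terminal_bonus_def)
  qed
qed

lemma controlled_value_add_loop:
  assumes "R \<noteq> {#}"
  shows "controlled_value (add_mset (Loop n) R)
    = controlled_value R + int n - 8 + (if set_mset R = {Chain 3} then 2 else 0)"
proof -
  have "set_mset R = {Chain 3} \<Longrightarrow> terminal_bonus R = 4"
    using assms by (simp add: terminal_bonus_def)
  then show ?thesis
    using assms by (auto simp: controlled_value_add terminal_bonus_add_loop)
qed

lemma controlled_value_add_3_chain:
  "R \<noteq> {#} \<Longrightarrow> controlled_value (add_mset (Chain 3) R)
    = controlled_value R - 1 - (if \<forall>C\<in>#R. is_loop C then 2 else 0)"
  by (simp add: controlled_value_add terminal_bonus_add_3_chain terminal_bonus_all_loops)

lemma all_3_chains: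
  assumes "set_mset R = {Chain 3}"
  shows "controlled_value R = 4 - int (count R (Chain 3))" "1 \<le> count R (Chain 3)" "count R (Loop 4) = 0"
    "R = replicate_mset (count R (Chain 3)) (Chain 3)" "boxes R = 3 * count R (Chain 3)"
proof -
  obtain k where R: "R = replicate_mset (Suc k) (Chain 3)"
    using assms set_mset_subset_singletonD[of R "Chain 3"]
    by (metis dual_order.refl empty_not_insert not0_implies_Suc replicate_mset_0 set_mset_empty)
  have "filter_mset is_chain (replicate_mset n (Chain 3)) = replicate_mset n (Chain 3)"
    and "filter_mset is_loop (replicate_mset n (Chain 3)) = {#}" for n
    by (induction n) simp_all
  then show "controlled_value R = 4 - int (count R (Chain 3))" "1 \<le> count R (Chain 3)" "count R (Loop 4) = 0"
    "R = replicate_mset (count R (Chain 3)) (Chain 3)" "boxes R = 3 * count R (Chain 3)"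
    unfolding R by (simp_all add: controlled_value_def terminal_bonus_def boxes_def del: replicate_mset_Suc)
qed

lemma boxes_ge_3_chains: "3 * count G (Chain 3) \<le> boxes G"
  by (induction G) auto

text \<open>
  This recognises the rest \<open>3+3\<close>, whose value deviates, by its numbers.
\<close>
lemma all_3_chains_if_boxes_eq:
  assumes "valid_position R" "R \<noteq> {#}" "boxes R = 3 * count R (Chain 3)"
  shows "set_mset R = {Chain 3}"
proof -
  have "C = Chain 3" if "C \<in># R" for C
  proof (rule ccontr)
    assume "C \<noteq> Chain 3"
    moreover obtain R' where "R = add_mset C R'" using \<open>C \<in># R\<close> by (blast dest: multi_member_split)
    ultimately show False
      using assms(1,3) boxes_ge_3_chains[of R'] by (cases C) auto
  qed
  then show ?thesis using assms(2) by auto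
qed

text \<open>
  Apart from the terminal bonus a chain of length \<open>n\<close> contributes \<open>n - 4\<close> and a loop contributes \<open>n - 8\<close>, so
  only 3-chains and short loops pull the controlled value down. In particular a position
  without 3-chains whose controlled value is at most 1 has a 4-loop or a 6-loop.
\<close>
lemma controlled_value_no_short_loop:
  assumes "valid_position G" "\<And>n. Loop n \<in># G \<Longrightarrow> 8 \<le> n"
  shows "terminal_bonus G - int (count G (Chain 3)) \<le> controlled_value G"
proof -
  have "4 * size (filter_mset is_chain G) + 8 * size (filter_mset is_loop G)
      \<le> boxes G + count G (Chain 3)"
    using assms
  proof (induction G)
    case (add C G)
    then show ?case by (cases C) (fastforce)+
  qed simp
  then show ?thesis by (simp add: controlled_value_def)
qed

section \<open>No opening beats the formula\<close>

definition position_value :: "position \<Rightarrow> int" where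
  "position_value G = (if G = {#} then 0 else
     value_formula (controlled_value G) (int (count G (Chain 3))) (int (count G (Loop 4))) (int (boxes G)))"

lemma position_value_single:
  assumes "valid_component C"
  shows "position_value {#C#} = int (len C)"
  using assms
  by (cases C) (auto simp: position_value_def value_formula_def controlled_value_def terminal_bonus_def)

lemma position_value_ge_controlled_value:
  "R \<noteq> {#} \<Longrightarrow> controlled_value R \<le> position_value R"
  using value_formula_ge_controlled_value[OF controlled_value_parity[of R]] by (simp add: position_value_def)

lemma position_value_eq_controlled_value:
  "G \<noteq> {#} \<Longrightarrow> 2 \<le> controlled_value G \<Longrightarrow> position_value G = controlled_value G"
  by (simp add: position_value_def value_formula_def)

text \<open>
  The controller keeps control. As the rest is worth at least its controlled value, he obtains the
  controlled value of the whole position plus the change of the terminal bonus, which is negative only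
  when the last loop beside 3-chains is opened.
\<close>
lemma controlled_value_le_open_margin:
  assumes "R \<noteq> {#}"
  shows "controlled_value (add_mset C R) \<le> open_margin C (position_value R)"
proof (cases "is_loop C \<and> set_mset R = {Chain 3}")
  \<comment> \<open>The last loop beside 3-chains: here the terminal bonus falls from 6 to 4.\<close>
  case True
  then obtain n where C: "C = Loop n" by (cases C) auto
  note R = all_3_chains[OF conjunct2[OF True]]
  have c: "controlled_value (add_mset C R) = int n - 2 - int (count R (Chain 3))"
    using controlled_value_add_loop[OF assms, of n] True R(1) C by simp
  show ?thesis
  proof (cases "count R (Chain 3) = 1")
    case True
    then have "position_value R = 3" using R(1) assms position_value_eq_controlled_value by auto
    then show ?thesis using c True C by (simp add: open_margin_loop)
  next
    case False
    then have "2 \<le> count R (Chain 3)" using R(2) by linarith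
    then show ?thesis using c C by (simp add: open_margin_loop)
  qed
next
  case False
  have "terminal_bonus (add_mset C R) \<le> terminal_bonus R"
  proof (cases C)
    case (Chain n)
    then show ?thesis
      using assms terminal_bonus_add_3_chain[of R] terminal_bonus_long_chain[of "Chain n" "add_mset (Chain n) R"]
        terminal_bonus_ge_4[of R] terminal_bonus_all_loops[of R]
      by (cases "n = 3") (auto split: if_splits)
  next
    case (Loop n)
    then show ?thesis using False assms terminal_bonus_add_loop[of R n] by simp
  qed
  then show ?thesis using controlled_value_add[of C R] position_value_ge_controlled_value[OF assms]
    by (simp add: open_margin_def)
qed

text \<open>
  The value is at most 4, which every chain of length at least 6 and every loop of length at least 8
  exceeds or matches through the boxes that the controller takes.
\<close>
lemma position_value_le_open_margin_low:
  assumes "R \<noteq> {#}" "valid_position (add_mset C R)" "controlled_value (add_mset C R) \<le> 1"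
  shows "position_value (add_mset C R) \<le> open_margin C (position_value R)"
proof -
  define c where "c = controlled_value (add_mset C R)"
  define c' where "c' = controlled_value R"
  define a where "a = int (count R (Chain 3))"
  define b where "b = int (count R (Loop 4))"
  define s where "s = int (boxes R)"
  have w: "position_value R = value_formula c' a b s"
    using assms(1) by (simp add: position_value_def c'_def a_def b_def s_def)
  have v: "position_value (add_mset C R) = low_value c (int (count (add_mset C R) (Chain 3)))
      (int (count (add_mset C R) (Loop 4))) (s + int (len C))"
    using assms(3) by (simp add: position_value_def value_formula_def c_def s_def add.commute)
  have ab: "0 \<le> a" "0 \<le> b" by (simp_all add: a_def b_def)
  have par: "even (c' - s)" unfolding c'_def s_def by (rule controlled_value_parity)
  have mod4: "a = 0 \<Longrightarrow> 4 dvd c' - s"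
    unfolding a_def c'_def s_def by (intro controlled_value_mod_4) (simp add: count_eq_zero_iff)
  have low4: "position_value (add_mset C R) \<le> 4" by (simp add: v low_value_range)
  show ?thesis
  proof (cases C)
    case (Chain n)
    then consider "n = 3" | "n = 4" | "n = 5" | "6 \<le> n" using assms(2) by fastforce
    then show ?thesis
    proof cases
      case 1
      then show ?thesis
        using low_value_le_opening_3_chain[OF ab(1) par mod4, of c b] v w 1 Chain
        by (simp add: open_margin_chain a_def b_def add.commute)
    next
      case 2
      then show ?thesis
        using low_value_le_opening_4_chain[where c = c and b = b, OF par mod4] v w 2 Chain
        by (simp add: open_margin_chain a_def b_def)
    next
      case 3
      then show ?thesis
        using low_value_le_opening_5_chain[OF par, of c a b] v w 3 Chain
        by (simp add: open_margin_chain a_def b_def)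
    next
      case 4
      then show ?thesis using low4 Chain by (simp add: open_margin_chain)
    qed
  next
    case (Loop n)
    then consider "n = 4" | "n = 6" | "8 \<le> n" using assms(2) by fastforce
    then show ?thesis
    proof cases
      case 1
      then have cc: "c = c' - 4 + (if set_mset R = {Chain 3} then 2 else 0)"
        using controlled_value_add_loop[OF assms(1), of 4] Loop by (simp add: c_def c'_def)
      have threes: "set_mset R = {Chain 3} \<Longrightarrow> c' = 4 - a \<and> 1 \<le> a"
        using all_3_chains[of R] by (simp add: c'_def a_def)
      have "low_value c a (b + 1) (s + 4) \<le> \<bar>value_formula c' a b s - 4\<bar>"
      proof (cases "a = 0")
        case True
        then have "c' = c + 4" using cc threes by auto
        moreover from this have "4 dvd c - s" using mod4[OF True] by presburger
        ultimately show ?thesis using True low_value_reflected_by_4_loop[of c b s] ab assms(3) by (simp add: c_def)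
      next
        case False
        \<comment> \<open>What is left consists of two 3-chains.\<close>
        have "c' = 2" if "a = 2" "b = 0" "s = 6"
        proof -
          have "boxes R = 3 * count R (Chain 3)" using that by (simp add: a_def s_def)
          then show ?thesis using all_3_chains_if_boxes_eq[of R] assms(1,2) threes that(1) by simp
        qed
        moreover have "c' \<le> c + 4" "a = 1 \<Longrightarrow> c \<le> -2 \<Longrightarrow> c' = c + 4"
          using cc threes by (auto split: if_splits)
        ultimately show ?thesis
          using False ab par assms(3) low_value_le_opening_4_loop[of a b c' s c] by (simp add: c_def)
      qed
      then show ?thesis
        using v w 1 Loop by (simp add: open_margin_loop a_def b_def add.commute)
    next
      case 2
      then show ?thesis
        using low_value_le_opening_6_loop[where c = c and b = b, OF par mod4] v w 2 Loop
        by (simp add: open_margin_loop a_def b_def)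
    next
      case 3
      then show ?thesis using low4 Loop by (simp add: open_margin_loop)
    qed
  qed
qed

lemma position_value_le_open_margin_add:
  assumes "valid_position (add_mset C R)"
  shows "position_value (add_mset C R) \<le> open_margin C (position_value R)"
proof (cases "R = {#}")
  case True
  then show ?thesis
    using assms position_value_single[of C] by (simp add: open_margin_0 position_value_def)
next
  case False
  then show ?thesis
    using assms controlled_value_le_open_margin[OF False, of C] position_value_le_open_margin_low[OF False assms]
      position_value_eq_controlled_value[of "add_mset C R"]
    by (cases "2 \<le> controlled_value (add_mset C R)") auto
qed

lemma position_value_le_open_margin:
  assumes "valid_position G" "C \<in># G"
  shows "position_value G \<le> open_margin C (position_value (G - {#C#}))"
  using position_value_le_open_margin_add[of C "G - {#C#}"] assms by simp

section \<open>The recommended opening attains the formula\<close>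

text \<open>
  At low controlled values only the second and third exceptional case are possible.
\<close>
lemma exceptional_low: "exceptional G \<Longrightarrow> controlled_value G \<le> 1 \<Longrightarrow> Loop 4 \<in># G"
  by (auto simp: exceptional_def)

lemma exceptional_has_loop:
  assumes "exceptional G"
  shows "\<exists>C\<in>#G. is_loop C"
proof (cases "controlled_value G \<le> 1")
  case True
  then show ?thesis using exceptional_low[OF assms] by force
next
  case False
  then obtain L where L: "L \<noteq> {#}" "\<forall>C\<in>#L. is_loop C" "G = {#Chain 3#} + L"
    using assms unfolding exceptional_def one_three_chain_and_loops_def by auto
  obtain C where "C \<in># L" using L(1) by blast
  then show ?thesis using L by auto
qed

lemma exceptional_high:
  "exceptional G \<Longrightarrow> 2 \<le> controlled_value G \<Longrightarrow> one_three_chain_and_loops G"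
  by (auto simp: exceptional_def)

lemma opening_3_chain_attains:
  assumes "\<not> exceptional (add_mset (Chain 3) R)"
  shows "open_margin (Chain 3) (position_value R) \<le> position_value (add_mset (Chain 3) R)"
proof (cases "R = {#}")
  case True
  then show ?thesis
    using position_value_single[of "Chain 3"] by (simp add: open_margin_0 position_value_def)
next
  case R: False
  let ?G = "add_mset (Chain 3) R"
  define c where "c = controlled_value ?G"
  define c' where "c' = controlled_value R"
  define a where "a = int (count R (Chain 3))"
  define b where "b = int (count R (Loop 4))"
  define s where "s = int (boxes R)"
  have cc: "c = c' - 1 - (if \<forall>C\<in>#R. is_loop C then 2 else 0)"
    using controlled_value_add_3_chain[OF R] by (simp add: c_def c'_def)
  have w: "position_value R = value_formula c' a b s"
    using R by (simp add: position_value_def c'_def a_def b_def s_def)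
  show ?thesis
  proof (cases "2 \<le> c")
    case True
    have "\<not> one_three_chain_and_loops ?G"
      using assms True by (auto simp: exceptional_def c_def)
    then have "\<not> (\<forall>C\<in>#R. is_loop C)"
      using R by (auto simp: one_three_chain_and_loops_def)
    then have "c = c' - 1" using cc by simp
    then show ?thesis
      using True position_value_eq_controlled_value[OF R] position_value_eq_controlled_value[of ?G]
      by (simp add: open_margin_chain c_def c'_def)
  next
    case False
    have par: "even (c' - s)" unfolding c'_def s_def by (rule controlled_value_parity)
    have no_threes: "Chain 3 \<notin># R" if "a = 0"
      using that by (simp add: a_def count_eq_zero_iff)
    have mod4: "4 dvd c' - s" if "a = 0"
      using controlled_value_mod_4[OF no_threes[OF that]] by (simp add: c'_def s_def)
    \<comment> \<open>The controlled value rises by 3 if only loops remain: the terminal bonus grows from 6 to 8.\<close>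
    have step: "c' = c + 1 \<or> a = 0 \<and> c' = c + 3"
    proof (cases "\<forall>C\<in>#R. is_loop C")
      case True
      then have "Chain 3 \<notin># R" by force
      then show ?thesis using cc True by (simp add: a_def count_eq_zero_iff)
    next
      case False
      then show ?thesis using cc unfolding if_not_P[OF False] by simp
    qed
    have four: "\<exists>H. R = add_mset (Loop 4) H" if "0 < b"
    proof -
      have "Loop 4 \<in># R" using that by (simp add: b_def)
      then show ?thesis by (rule multi_member_split)
    qed
    \<comment> \<open>With a 4-loop and c in -1, 0, 1 only \<open>4\<^sub>l+3+3+3\<close> is not exceptional, so \<open>4\<^sub>l+3+3\<close> is left.\<close>
    have special: "a = 2 \<and> b = 1 \<and> s = 10" if "-1 \<le> c" "0 < b"
    proof -
      obtain H where H: "R = add_mset (Loop 4) H" using four \<open>0 < b\<close> by blast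
      have "?G = {#Loop 4#} + add_mset (Chain 3) H" using H by simp
      moreover have "c \<in> {-1, 0, 1}" using \<open>-1 \<le> c\<close> False by auto
      ultimately have "add_mset (Chain 3) H = {#Chain 3, Chain 3, Chain 3#}"
        using assms unfolding exceptional_def c_def by blast
      then have "R = {#Loop 4, Chain 3, Chain 3#}" using H by simp
      then show ?thesis by (simp add: a_def b_def s_def)
    qed
    \<comment> \<open>Otherwise opening the 4-loop could be cheaper, which is the third exceptional case.\<close>
    have no_flip: "\<not> 4 dvd s" if "a = 0" "0 < b"
    proof
      assume "4 dvd s"
      obtain H where H: "R = add_mset (Loop 4) H" using four \<open>0 < b\<close> by blast
      have "c \<le> -2" using special that by force
      moreover have "?G = {#Loop 4, Chain 3#} + H" using H by simp
      moreover have "boxes R = 4 + boxes H" using H by simp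
      then have "4 dvd boxes H" using \<open>4 dvd s\<close> unfolding s_def by presburger
      moreover have "Chain 3 \<notin># H" using no_threes[OF \<open>a = 0\<close>] H by simp
      ultimately show False
        using assms unfolding exceptional_def c_def by blast
    qed
    have "1 + \<bar>value_formula c' a b s - 2\<bar> \<le> low_value c (a + 1) b (s + 3)"
      using False step par mod4 special no_flip
      by (intro opening_3_chain_le_low_value) (auto simp: a_def b_def)
    moreover have "position_value ?G = low_value c (a + 1) b (s + 3)"
      using False by (simp add: position_value_def value_formula_def c_def a_def b_def s_def add.commute)
    ultimately show ?thesis by (simp add: w open_margin_chain)
  qed
qed

text \<open>
  Among chains of length at least 4 all controlled values are at least 4, so the controller keeps
  control to the end, and every opening attains the controlled value.
\<close>
lemma opening_chain_attains:
  assumes "valid_position (add_mset (Chain n) R)" "n \<noteq> 3" "Chain 3 \<notin># R" "\<not> (\<exists>C\<in>#R. is_loop C)"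
  shows "open_margin (Chain n) (position_value R) \<le> position_value (add_mset (Chain n) R)"
proof (cases "R = {#}")
  case True
  then show ?thesis
    using assms(1) position_value_single[of "Chain n"] by (simp add: open_margin_0 position_value_def)
next
  case R: False
  let ?G = "add_mset (Chain n) R"
  obtain C where C: "C \<in># R" using R by blast
  then have tb: "terminal_bonus R = 4" "terminal_bonus ?G = 4"
    using assms(2-4) terminal_bonus_long_chain[of C R] terminal_bonus_long_chain[of "Chain n" ?G]
    by auto
  have no_loop: "Loop m \<notin># R" for m
    using assms(4) by force
  then have "4 \<le> controlled_value R"
    using controlled_value_no_short_loop[of R] assms tb
    by (simp add: count_eq_zero_iff[THEN iffD2])
  moreover have "4 \<le> controlled_value ?G"
    using no_loop controlled_value_no_short_loop[of ?G] assms tb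
    by (simp add: count_eq_zero_iff[THEN iffD2])
  ultimately  show ?thesis
    using position_value_eq_controlled_value[OF R] position_value_eq_controlled_value[of ?G] tb controlled_value_add[of "Chain n" R]
    by (simp add: open_margin_chain)
qed

text \<open>
  Unless a single 3-chain is left, the controlled value after the opening is at least 4 and the controller
  keeps control.
  Opening a long loop while short ones remain could leave a smaller controlled value, which is why the
  loop has to be a shortest one. A single 3-chain is worth 3 and gives the margin \<open>n - 3\<close>, which is the
  controlled value since the terminal bonus falls from 6 to 4.
\<close>
lemma opening_shortest_loop_attains_high:
  assumes "valid_position (add_mset (Loop n) R)" "2 \<le> controlled_value (add_mset (Loop n) R)" "R \<noteq> {#}"
    and shortest: "\<And>m. Loop m \<in># R \<Longrightarrow> n \<le> m"
    and "Chain 3 \<notin># R \<or> one_three_chain_and_loops (add_mset (Loop n) R)"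
  shows "open_margin (Loop n) (position_value R) \<le> controlled_value (add_mset (Loop n) R)"
proof -
  have one: "count R (Chain 3) = 1 \<and> (\<forall>C\<in>#R. is_loop C \<or> C = Chain 3)" if "Chain 3 \<in># R"
  proof -
    have "one_three_chain_and_loops (add_mset (Loop n) R)" using assms(5) that by simp
    then obtain L where L: "\<forall>C\<in>#L. is_loop C" "add_mset (Loop n) R = {#Chain 3#} + L"
      unfolding one_three_chain_and_loops_def by (elim exE conjE)
    have "count L (Chain 3) = 0" using L(1) by (force simp: count_eq_zero_iff)
    then have "count (add_mset (Loop n) R) (Chain 3) = 1" unfolding L(2) by simp
    moreover have "\<forall>C\<in>#add_mset (Loop n) R. is_loop C \<or> C = Chain 3" unfolding L(2) using L(1) by simp
    ultimately show ?thesis by simp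
  qed
  show ?thesis
  proof (cases "set_mset R = {Chain 3}")
    case True
    then have "controlled_value R = 3" using all_3_chains(1)[OF True] one by simp
    then show ?thesis
      using True position_value_eq_controlled_value[OF assms(3)] controlled_value_add_loop[OF assms(3), of n]
      by (simp add: open_margin_loop)
  next
    case False
    then have c: "controlled_value (add_mset (Loop n) R) = controlled_value R + int n - 8"
      using controlled_value_add_loop[OF assms(3), of n] by simp
    have "4 \<le> controlled_value R"
    proof (cases "8 \<le> n")
      \<comment> \<open>No loop left is short, so the controlled value is at least the terminal bonus, less 1 for a 3-chain.\<close>
      case True
      have v: "valid_position R" using assms(1) by simp
      have "terminal_bonus R - int (count R (Chain 3)) \<le> controlled_value R"
        using controlled_value_no_short_loop[OF v] shortest True by (meson order.trans)
      moreover have "6 = terminal_bonus R" if "Chain 3 \<in># R"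
      proof -
        have "\<exists>C\<in>#R. is_loop C" using one[OF that] False that by blast
        then show ?thesis using one[OF that] that terminal_bonus_3_chains_and_loops by simp
      qed
      ultimately show ?thesis
        using one terminal_bonus_ge_4[OF assms(3)] by (cases "Chain 3 \<in># R") (auto simp: not_in_iff)
    next
      case False
      \<comment> \<open>Removing a loop that is shorter than 8 raises the controlled value.\<close>
      then have "n = 4 \<or> n = 6" using assms(1) by fastforce
      then show ?thesis using assms(2) c by auto
    qed
    then show ?thesis
      using c position_value_eq_controlled_value[OF assms(3)] by (simp add: open_margin_loop)
  qed
qed

text \<open>
  A shortest loop of a position without 3-chains has length 4 or 6, since the controlled value would be
  at least 4 otherwise. In an exceptional position it is a 4-loop.
\<close>
lemma opening_shortest_loop_attains_low:
  assumes "valid_position (add_mset (Loop n) R)" "controlled_value (add_mset (Loop n) R) \<le> 1" "R \<noteq> {#}"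
    and shortest: "\<And>m. Loop m \<in># R \<Longrightarrow> n \<le> m"
    and "Chain 3 \<notin># R \<or> exceptional (add_mset (Loop n) R)"
  shows "open_margin (Loop n) (position_value R) \<le> position_value (add_mset (Loop n) R)"
proof -
  let ?G = "add_mset (Loop n) R"
  define c where "c = controlled_value ?G"
  define c' where "c' = controlled_value R"
  define a where "a = int (count R (Chain 3))"
  define b where "b = int (count R (Loop 4))"
  define s where "s = int (boxes R)"
  have c1: "c \<le> 1" using assms(2) by (simp add: c_def)
  have ab: "0 \<le> a" "0 \<le> b" by (simp_all add: a_def b_def)
  have w: "position_value R = value_formula c' a b s"
    using assms(3) by (simp add: position_value_def c'_def a_def b_def s_def)
  have cc: "c = c' + int n - 8 + (if set_mset R = {Chain 3} then 2 else 0)"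
    using controlled_value_add_loop[OF assms(3)] by (simp add: c_def c'_def)
  have par: "even (c' - s)" unfolding c'_def s_def by (rule controlled_value_parity)
  have no_threes: "Chain 3 \<notin># R" if "a = 0"
    using that by (simp add: a_def count_eq_zero_iff)
  have mod4: "4 dvd c' - s" if "a = 0"
    using controlled_value_mod_4[OF no_threes[OF that]] by (simp add: c'_def s_def)
  have four: "n = 4" if "exceptional ?G"
  proof -
    have "Loop 4 \<in># ?G" using exceptional_low[OF that] c1 unfolding c_def by blast
    moreover have "4 \<le> n" using assms(1) by simp
    ultimately show ?thesis using shortest by (auto intro: le_antisym)
  qed
  consider "n = 4" | "n = 6" | "8 \<le> n" using assms(1) by fastforce
  then show ?thesis
  proof cases
    case 1
    have v: "position_value ?G = low_value c a (b + 1) (s + 4)"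
      using c1 1 by (simp add: position_value_def value_formula_def c_def a_def b_def s_def add.commute)
    have "\<bar>value_formula c' a b s - 4\<bar> = low_value c a (b + 1) (s + 4)"
    proof (cases "a = 0")
      case True
      then have "c' = c + 4" using cc 1 no_threes by auto
      moreover from this have "4 dvd c - s" using mod4[OF True] by presburger
      ultimately show ?thesis
        using True low_value_reflected_by_4_loop[of c b s] c1 ab by simp
    next
      case False
      then have exc: "exceptional ?G" using assms(5) by (auto simp: a_def not_in_iff)
      have threes: "c' = 4 - a \<and> b = 0" if "set_mset R = {Chain 3}"
        using all_3_chains[OF that] by (simp add: c'_def a_def b_def)
      show ?thesis
      proof (cases "-1 \<le> c")
        case True
        \<comment> \<open>If only 3-chains remain, there are at most two: c = 2 - a, and \<open>4\<^sub>l+3+3+3\<close> is not exceptional.\<close>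
        have "a = 1 \<or> a = 2" if R: "set_mset R = {Chain 3}"
        proof -
          have "a \<noteq> 3"
          proof
            assume "a = 3"
            then have "R = replicate_mset 3 (Chain 3)"
              using all_3_chains(4)[OF R] by (simp add: a_def)
            then have "R = {#Chain 3, Chain 3, Chain 3#}"
              by (simp add: numeral_3_eq_3)
            moreover have "\<exists>H. ?G = {#Loop 4#} + H \<and> H \<noteq> {#Chain 3, Chain 3, Chain 3#}"
              using exc True c1 by (auto simp: exceptional_def c_def)
            ultimately show False using 1 by auto
          qed
          moreover have "a \<le> 3" using threes[OF R] cc R 1 True by simp
          ultimately show ?thesis using False ab by arith
        qed
        then have "c' = c + 4 \<or> c' = 3 \<and> c = 1 \<or> c' = 2 \<and> a = 2 \<and> b = 0 \<and> s = 6"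
          using threes cc 1 all_3_chains(5)[of R] by (force simp: a_def s_def split: if_splits)
        moreover have "c' = 2" if "a = 2" "b = 0" "s = 6"
        proof -
          have "set_mset R = {Chain 3}"
            using that assms(1,3) by (intro all_3_chains_if_boxes_eq) (auto simp: a_def s_def)
          then show ?thesis using threes that by simp
        qed
        ultimately show ?thesis
          using False ab par True c1 by (intro low_value_eq_opening_4_loop_near_0) auto
      next
        case low: False
        then obtain H where H: "?G = {#Loop 4, Chain 3#} + H" "4 dvd boxes H" "Chain 3 \<notin># H"
          using exc c1 unfolding exceptional_def c_def by auto
        then have "R = add_mset (Chain 3) H" using 1 by simp
        then have "a = 1" "s = 3 + int (boxes H)"
          using H(3) by (simp_all add: a_def s_def not_in_iff)
        moreover have "s mod 4 = 3" using H(2) \<open>s = 3 + int (boxes H)\<close> by presburger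
        moreover have "c' = c + 4" using low cc 1 threes \<open>a = 1\<close> by (auto split: if_splits)
        ultimately show ?thesis using low_value_eq_opening_4_loop_one_3_chain[of b c s] low ab par by auto
      qed
    qed
    then show ?thesis using v w 1 by (simp add: open_margin_loop)
  next
    case 2
    then have "\<not> exceptional ?G" using four by auto
    then have "a = 0" using assms(5) by (simp add: a_def not_in_iff)
    moreover have "b = 0" using shortest[of 4] 2 by (force simp: b_def count_eq_zero_iff)
    moreover have "c' = c + 2" using cc 2 no_threes \<open>a = 0\<close> by auto
    moreover have "position_value ?G = low_value c a b (s + 6)"
      using c1 2 by (simp add: position_value_def value_formula_def c_def a_def b_def s_def add.commute)
    ultimately show ?thesis
      using low_value_eq_opening_6_loop[of c s] mod4 c1 w 2 by (simp add: open_margin_loop)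
  next
    case 3
    then have "\<not> exceptional ?G" using four by auto
    then have "Chain 3 \<notin># ?G" using assms(5) by simp
    moreover have "8 \<le> m" if "Loop m \<in># ?G" for m
      using that shortest 3 by (auto intro: order.trans)
    ultimately have "4 \<le> c"
      using controlled_value_no_short_loop[OF assms(1)] terminal_bonus_ge_4[of ?G]
      by (fastforce simp: c_def not_in_iff)
    then show ?thesis using c1 by simp
  qed
qed

lemma shortest_loop_attains:
  assumes "valid_position G" "\<exists>C\<in>#G. is_loop C" "Chain 3 \<notin># G \<or> exceptional G"
  shows "shortest_loop G \<in># G"
    and "open_margin (shortest_loop G) (position_value (G - {#shortest_loop G#})) \<le> position_value G"
proof -
  define n where "n = (LEAST n. Loop n \<in># G)"
  have "\<exists>n. Loop n \<in># G"
    using assms(2) by (metis is_loop_def)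
  then have n: "Loop n \<in># G" unfolding n_def by (rule LeastI_ex)
  have least: "n \<le> m" if "Loop m \<in># G" for m
    unfolding n_def using that by (rule Least_le)
  have S: "shortest_loop G = Loop n" by (simp add: shortest_loop_def n_def)
  then show "shortest_loop G \<in># G" using n by simp
  define R where "R = G - {#Loop n#}"
  have G: "G = add_mset (Loop n) R" using n by (simp add: R_def)
  have least_R: "n \<le> m" if "Loop m \<in># R" for m
    using least[of m] that by (simp add: G)
  have "open_margin (Loop n) (position_value R) \<le> position_value G"
  proof (cases "R = {#}")
    case True
    then show ?thesis
      using assms(1) G position_value_single[of "Loop n"]
      by (simp add: open_margin_0 position_value_def[of "{#}"])
  next
    case R: False
    show ?thesis
    proof (cases "2 \<le> controlled_value G")
      case True
      then have "Chain 3 \<notin># R \<or> one_three_chain_and_loops G"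
        using assms(3) exceptional_high G by auto
      then show ?thesis
        using opening_shortest_loop_attains_high[of n R] assms(1) True R least_R position_value_eq_controlled_value[of G]
        by (simp add: G)
    next
      case False
      have "Chain 3 \<notin># R \<or> exceptional G"
        using assms(3) G by auto
      then show ?thesis
        using opening_shortest_loop_attains_low[of n R] assms(1) False R least_R by (simp add: G)
    qed
  qed
  then show "open_margin (shortest_loop G) (position_value (G - {#shortest_loop G#})) \<le> position_value G"
    by (simp add: S R_def)
qed

definition recommended_move :: "position \<Rightarrow> component" where
  "recommended_move G = (if exceptional G then shortest_loop G else standard_move G)"

lemma recommended_move_attains:
  assumes "valid_position G" "G \<noteq> {#}"
  shows "recommended_move G \<in># G"
    and "open_margin (recommended_move G) (position_value (G - {#recommended_move G#}))
           \<le> position_value G"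
proof -
  have "recommended_move G \<in># G \<and>
    open_margin (recommended_move G) (position_value (G - {#recommended_move G#})) \<le> position_value G"
  proof (cases "exceptional G")
    case True
    then have "\<exists>C\<in>#G. is_loop C"
      by (rule exceptional_has_loop)
    then show ?thesis
      using shortest_loop_attains[OF assms(1)] True by (simp add: recommended_move_def)
  next
    case ne: False
    show ?thesis
    proof (cases "Chain 3 \<in># G")
      case True
      then obtain R where "G = add_mset (Chain 3) R" by (blast dest: multi_member_split)
      then show ?thesis
        using opening_3_chain_attains[of R] ne by (simp add: recommended_move_def standard_move_def)
    next
      case no_three: False
      show ?thesis
      proof (cases "\<exists>C\<in>#G. is_loop C")
        case True
        then show ?thesis
          using shortest_loop_attains[OF assms(1) True] ne no_three
          by (simp add: recommended_move_def standard_move_def)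
      next
        case False
        define n where "n = (LEAST n. Chain n \<in># G)"
        obtain C where "C \<in># G" using assms(2) by blast
        then have "\<exists>n. Chain n \<in># G" using False by (cases C) auto
        then have n: "Chain n \<in># G" unfolding n_def by (rule LeastI_ex)
        then obtain R where R: "G = add_mset (Chain n) R" by (blast dest: multi_member_split)
        have move: "recommended_move G = Chain n"
          using ne no_three False by (simp add: recommended_move_def standard_move_def shortest_chain_def n_def)
        have "n \<noteq> 3" "Chain 3 \<notin># R" "\<not> (\<exists>C\<in>#R. is_loop C)"
          using n no_three False R by auto
        then show ?thesis
          unfolding move using n opening_chain_attains[of n R] assms(1) by (simp add: R)
      qed
    qed
  qed
  then show "recommended_move G \<in># G"
    and "open_margin (recommended_move G) (position_value (G - {#recommended_move G#}))
           \<le> position_value G"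
    by auto
qed

section \<open>The value of a position and its optimal openings\<close>

lemma val_eq_position_value: "valid_position G \<Longrightarrow> val G = position_value G"
proof (induction "size G" arbitrary: G rule: less_induct)
  case less
  show ?case
  proof (cases "G = {#}")
    case True
    then show ?thesis by (simp add: val.simps position_value_def)
  next
    case False
    let ?m = "\<lambda>C. open_margin C (position_value (G - {#C#}))"
    have IH: "val (G - {#C#}) = position_value (G - {#C#})" if "C \<in># G" for C
      using size_Diff1_less[OF that] valid_position_diff[OF less.prems] by (rule less.hyps)
    note bound = position_value_le_open_margin[OF less.prems]
    have "val G = Min (?m ` set_mset G)"
      using False IH by (subst val.simps) (simp cong: image_cong)
    also have "\<dots> = position_value G"
    proof (rule Min_eqI)
      have "?m (recommended_move G) = position_value G"
        using recommended_move_attains[OF less.prems False] bound by (intro antisym) auto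
      then show "position_value G \<in> ?m ` set_mset G"
        using recommended_move_attains(1)[OF less.prems False] by (intro image_eqI[where x = "recommended_move G"]) simp_all
    qed (use bound in auto)
    finally show ?thesis .
  qed
qed

theorem theorem1p1:
  fixes G :: position
  assumes "valid_position G" and "G \<noteq> {#}"
  shows "(exceptional G \<longrightarrow> optimal_opening G (shortest_loop G)) \<and>
         (\<not> exceptional G \<longrightarrow> optimal_opening G (standard_move G))"
proof -
  let ?C = "recommended_move G"
  note C = recommended_move_attains[OF assms]
  have "val_open G ?C = open_margin ?C (position_value (G - {#?C#}))"
    using assms(1) by (simp add: val_open_def val_eq_position_value valid_position_diff)
  also have "\<dots> = position_value G"
    using C position_value_le_open_margin[OF assms(1)] by (intro antisym)
  finally have "optimal_opening G ?C"
    using C(1) assms(1) by (simp add: optimal_opening_def val_eq_position_value)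
  then show ?thesis unfolding recommended_move_def by (auto split: if_splits)
qed

end
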